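(* Let $q,a$ be integers, both different from $0,1,-1$, and let $p$ be an odd prime. (i) Let $\Phi_p(q)=\frac{q^p-1}{q-1}$. If $\Phi_p(q)$ is a prime not dividing $a^2-1$, and $\epsilon=\left(\frac{a^2-1}{\Phi_p(q)}\right)$, then $$T_{q^p}(a)\equiv T_{q+\epsilon-1}(a) \pmod{\Phi_p(q)},\qquad U_{q^p-\epsilon(q-1)-2}(a)\equiv 0 \pmod{\Phi_p(q)}.$$ (ii) More generally, let $r$ be an integer with $\gcd(q,r)=1$ and let $\Phi_p(q,r)=\frac{q^p-r^p}{q-r}$. If $\Phi_p(q,r)$ is prime and $\epsilon=\left(\frac{a^2-1}{\Phi_p(q,r)}\right)$, then $$T_{q^p-r^p}(a)\equiv T_{q-r}(a) \pmod{\Phi_p(q,r)},\qquad U_{q^p-r^p-\epsilon(q-r)-1}(a)\equiv 0 \pmod{\Phi_p(q,r)}.$$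
   Context: $\left(\frac{\cdot}{\cdot}\right)$ denotes the Legendre symbol (with value $0$ when the lower entry divides the upper one). $T_n$ and $U_n$ are the Chebyshev polynomials of the first and second kind, extended to all integer indices $n\in\mathbb{Z}$ by the recursions $T_{n+1}(x)=2xT_n(x)-T_{n-1}(x)$, $T_0=1$, $T_1=x$, and $U_{n+1}(x)=2xU_n(x)-U_{n-1}(x)$, $U_0=1$, $U_1=2x$; thus $T_{-n}=T_n$, $U_{-1}=0$ and $U_{-n}=-U_{n-2}$. Note that $q$ and $r$ may be negative, so the indices may be negative. *)

theory Defs
  imports
    "HOL-Number_Theory.Number_Theory"
    "HOL-Computational_Algebra.Polynomial"
begin

text \<open>
  The three-term recursion \<open>P (n + 1) = 2 x P n - P (n - 1)\<close> is run upwards from \<open>P 0\<close>, \<open>P 1\<close> for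
  \<open>n \<ge> 2\<close> and, solved for its last term, downwards for \<open>n < 0\<close>. The lemmas \<open>chebyshev_T_rec\<close> and
  \<open>chebyshev_U_rec\<close> below confirm that it then holds at every integer. The polynomial
  \<open>[:0, 2:]\<close> is \<open>2 x\<close>.
\<close>

function chebyshev_T :: "int \<Rightarrow> int poly" where
  "chebyshev_T n =
    (if n = 0 then 1
     else if n = 1 then [:0, 1:]
     else if n > 1 then [:0, 2:] * chebyshev_T (n - 1) - chebyshev_T (n - 2)
     else [:0, 2:] * chebyshev_T (n + 1) - chebyshev_T (n + 2))"
  by pat_completeness auto
termination
  by (relation "measure (\<lambda>n. nat (if n \<ge> 0 then n else 1 - n))") auto

function chebyshev_U :: "int \<Rightarrow> int poly" where
  "chebyshev_U n =
    (if n = 0 then 1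
     else if n = 1 then [:0, 2:]
     else if n > 1 then [:0, 2:] * chebyshev_U (n - 1) - chebyshev_U (n - 2)
     else [:0, 2:] * chebyshev_U (n + 1) - chebyshev_U (n + 2))"
  by pat_completeness auto
termination
  by (relation "measure (\<lambda>n. nat (if n \<ge> 0 then n else 1 - n))") auto

declare chebyshev_T.simps [simp del] chebyshev_U.simps [simp del]

lemma chebyshev_T_0: "chebyshev_T 0 = 1"
  and chebyshev_T_1: "chebyshev_T 1 = [:0, 1:]"
  by (simp_all add: chebyshev_T.simps)

lemma chebyshev_U_0: "chebyshev_U 0 = 1"
  and chebyshev_U_1: "chebyshev_U 1 = [:0, 2:]"
  by (simp_all add: chebyshev_U.simps)

lemma chebyshev_T_rec:
  "chebyshev_T (n + 1) = [:0, 2:] * chebyshev_T n - chebyshev_T (n - 1)"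
proof (cases "n \<ge> 1")
  case True
  then show ?thesis by (subst chebyshev_T.simps) simp
next
  case False
  then have "chebyshev_T (n - 1) = [:0, 2:] * chebyshev_T n - chebyshev_T (n + 1)"
    by (subst chebyshev_T.simps) (simp add: add.commute)
  then show ?thesis by simp
qed

lemma chebyshev_U_rec:
  "chebyshev_U (n + 1) = [:0, 2:] * chebyshev_U n - chebyshev_U (n - 1)"
proof (cases "n \<ge> 1")
  case True
  then show ?thesis by (subst chebyshev_U.simps) simp
next
  case False
  then have "chebyshev_U (n - 1) = [:0, 2:] * chebyshev_U n - chebyshev_U (n + 1)"
    by (subst chebyshev_U.simps) (simp add: add.commute)
  then show ?thesis by simp
qed

text \<open>
  The integer divisions below are exact, see \<open>Phi1_mult\<close> and \<open>Phi2_mult\<close>.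
\<close>

definition Phi1 :: "nat \<Rightarrow> int \<Rightarrow> int" where
  "Phi1 p q = (q ^ p - 1) div (q - 1)"

definition Phi2 :: "nat \<Rightarrow> int \<Rightarrow> int \<Rightarrow> int" where
  "Phi2 p q r = (q ^ p - r ^ p) div (q - r)"

lemma Phi2_mult: "(q - r) * Phi2 p q r = q ^ p - r ^ p"
proof -
  have "q - r dvd q ^ p - r ^ p"
    by (simp add: power_diff_sumr2)
  then show ?thesis by (simp add: Phi2_def)
qed

lemma Phi1_mult: "(q - 1) * Phi1 p q = q ^ p - 1"
  using Phi2_mult[of q 1 p] by (simp add: Phi1_def Phi2_def)

end

theory Submission
  imports Defs
begin

text \<open>
  Put \<open>d = a\<^sup>2 - 1\<close>, \<open>t n = T\<^bsub>n\<^esub>(a)\<close> and \<open>s n = U\<^bsub>n-1\<^esub>(a)\<close>, so that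
  \<open>(a + \<surd>d)\<^sup>n = t n + s n \<surd>d\<close>. Expanding the \<open>P\<close>-th power for an odd prime \<open>P\<close> gives
  \<open>t P \<equiv> a\<close> and \<open>s P \<equiv> d ^ ((P - 1) div 2) \<equiv> \<epsilon>\<close> modulo \<open>P\<close>. Both \<open>n \<mapsto> t (n P)\<close> and
  \<open>n \<mapsto> s (n P)\<close> satisfy the recursion with multiplier \<open>2 t P \<equiv> 2 a\<close>, hence
  \<open>t (n P) \<equiv> t n\<close> and \<open>s (n P) \<equiv> \<epsilon> s n\<close> for all integers \<open>n\<close>, also when \<open>\<epsilon> = 0\<close>. The theorem
  follows from the addition formulas with \<open>n = q - r\<close>, since \<open>q\<^sup>p - r\<^sup>p = n P\<close>.
\<close>

section \<open>Values at \<open>a\<close> and uniqueness of solutions of the recursion\<close>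

definition cheb_t :: "int \<Rightarrow> int \<Rightarrow> int" where
  "cheb_t a n = poly (chebyshev_T n) a"

definition cheb_s :: "int \<Rightarrow> int \<Rightarrow> int" where
  "cheb_s a n = poly (chebyshev_U (n - 1)) a"

lemma chebyshev_U_minus_1: "chebyshev_U (-1) = 0"
  using chebyshev_U_rec[of 0] by (simp add: chebyshev_U_0 chebyshev_U_1)

lemma cheb_t_0 [simp]: "cheb_t a 0 = 1"
  and cheb_t_1 [simp]: "cheb_t a 1 = a"
  and cheb_s_0 [simp]: "cheb_s a 0 = 0"
  and cheb_s_1 [simp]: "cheb_s a 1 = 1"
  by (simp_all add: cheb_t_def cheb_s_def chebyshev_T_0 chebyshev_T_1 chebyshev_U_0
      chebyshev_U_minus_1)

lemma cheb_t_rec: "cheb_t a (n + 1) = 2 * a * cheb_t a n - cheb_t a (n - 1)"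
  by (simp add: cheb_t_def chebyshev_T_rec)

lemma cheb_s_rec: "cheb_s a (n + 1) = 2 * a * cheb_s a n - cheb_s a (n - 1)"
  using chebyshev_U_rec[of "n - 1"] by (simp add: cheb_s_def)

text \<open>Two neighbouring values propagate in both directions without any division, because
  \<open>f (n - 1)\<close> has coefficient -1. Demanding the recursion only modulo \<open>m\<close>
  makes this applicable to \<open>cheb_t a (n * P)\<close> as a function of
  \<open>n\<close>.\<close>

lemma chebyshev_recursion_cong_unique:
  fixes f g :: "int \<Rightarrow> int"
  assumes f: "\<And>n. [f (n + 1) = 2 * x * f n - f (n - 1)] (mod m)"
    and g: "\<And>n. [g (n + 1) = 2 * x * g n - g (n - 1)] (mod m)"
    and "[f 0 = g 0] (mod m)" "[f 1 = g 1] (mod m)"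
  shows "[f n = g n] (mod m)"
proof -
  have "[f n = g n] (mod m) \<and> [f (n + 1) = g (n + 1)] (mod m)"
  proof (induction n rule: int_induct[where k = 0])
    case base
    then show ?case using assms by simp
  next
    case (step1 n)
    have "[2 * x * f (n + 1) - f n = 2 * x * g (n + 1) - g n] (mod m)"
      using step1 by (intro cong_diff cong_mult) auto
    then have "[f (n + 1 + 1) = g (n + 1 + 1)] (mod m)"
      using f[of "n + 1"] g[of "n + 1"] by (simp add: cong_def)
    with step1 show ?case by simp
  next
    case (step2 n)
    have down: "[h (n - 1) = 2 * x * h n - h (n + 1)] (mod m)"
      if "[h (n + 1) = 2 * x * h n - h (n - 1)] (mod m)" for h :: "int \<Rightarrow> int"
      using that by (simp add: cong_iff_dvd_diff algebra_simps)
    have "[2 * x * f n - f (n + 1) = 2 * x * g n - g (n + 1)] (mod m)"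
      using step2 by (intro cong_diff cong_mult) auto
    then have "[f (n - 1) = g (n - 1)] (mod m)"
      using down[of f, OF f[of n]] down[of g, OF g[of n]] by (simp add: cong_def)
    with step2 show ?case by simp
  qed
  then show ?thesis ..
qed

lemma chebyshev_recursion_unique:
  fixes f g :: "int \<Rightarrow> int"
  assumes "\<And>n. f (n + 1) = 2 * x * f n - f (n - 1)"
    and "\<And>n. g (n + 1) = 2 * x * g n - g (n - 1)"
    and "f 0 = g 0" "f 1 = g 1"
  shows "f n = g n"
  \<comment> \<open>Congruence modulo 0 is equality.\<close>
  using chebyshev_recursion_cong_unique[of f x 0 g n] assms by simp

section \<open>Parity in the index and addition formulas\<close>

lemma cheb_t_minus [simp]: "cheb_t a (- n) = cheb_t a n"
proof (rule chebyshev_recursion_unique[where x = a and n = n])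
  fix n show "cheb_t a (- (n + 1)) = 2 * a * cheb_t a (- n) - cheb_t a (- (n - 1))"
    using cheb_t_rec[of a "- n"] by (simp add: minus_diff_commute)
  show "cheb_t a (- 1) = cheb_t a 1"
    using cheb_t_rec[of a 0] by simp
qed (simp_all add: cheb_t_rec)

lemma cheb_s_minus [simp]: "cheb_s a (- n) = - cheb_s a n"
proof (rule chebyshev_recursion_unique[where x = a and n = n])
  fix n show "cheb_s a (- (n + 1)) = 2 * a * cheb_s a (- n) - cheb_s a (- (n - 1))"
    using cheb_s_rec[of a "- n"] by (simp add: minus_diff_commute)
  show "cheb_s a (- 1) = - cheb_s a 1"
    using cheb_s_rec[of a 0] by simp
qed (simp_all add: cheb_s_rec)

text \<open>The rational part of multiplying \<open>t n + s n sqrt d\<close> by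
  \<open>a + sqrt d\<close>; the coefficient of \<open>sqrt d\<close> is
  \<open>cheb_s_Suc\<close>.\<close>

lemma cheb_t_Suc: "cheb_t a (n + 1) = a * cheb_t a n + (a\<^sup>2 - 1) * cheb_s a n"
proof (rule chebyshev_recursion_unique[where x = a and n = n])
  show "cheb_t a (1 + 1) = a * cheb_t a 1 + (a\<^sup>2 - 1) * cheb_s a 1"
    by (simp only: cheb_t_rec) (simp add: power2_eq_square)
  fix n show "cheb_t a (n + 1 + 1) = 2 * a * cheb_t a (n + 1) - cheb_t a (n - 1 + 1)"
    using cheb_t_rec[of a "n + 1"] by simp
qed (simp_all add: cheb_t_rec cheb_s_rec algebra_simps)

lemma cheb_s_Suc: "cheb_s a (n + 1) = cheb_t a n + a * cheb_s a n"
proof (rule chebyshev_recursion_unique[where x = a and n = n])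
  show "cheb_s a (1 + 1) = cheb_t a 1 + a * cheb_s a 1"
    by (simp only: cheb_s_rec) simp
  fix n show "cheb_s a (n + 1 + 1) = 2 * a * cheb_s a (n + 1) - cheb_s a (n - 1 + 1)"
    using cheb_s_rec[of a "n + 1"] by simp
qed (simp_all add: cheb_t_rec cheb_s_rec algebra_simps)

text \<open>For fixed \<open>n\<close> both sides solve the recursion in \<open>m\<close>, so
  checking \<open>m = 0\<close> and \<open>m = 1\<close> suffices.\<close>

lemma cheb_t_add: "cheb_t a (m + n) = cheb_t a m * cheb_t a n + (a\<^sup>2 - 1) * cheb_s a m * cheb_s a n"
proof (rule chebyshev_recursion_unique[where x = a and n = m])
  fix m show "cheb_t a (m + 1 + n) = 2 * a * cheb_t a (m + n) - cheb_t a (m - 1 + n)"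
    using cheb_t_rec[of a "m + n"] by (simp add: algebra_simps)
  show "cheb_t a (1 + n) = cheb_t a 1 * cheb_t a n + (a\<^sup>2 - 1) * cheb_s a 1 * cheb_s a n"
    using cheb_t_Suc[of a n] by (simp add: add.commute)
qed (simp_all add: cheb_t_rec cheb_s_rec algebra_simps)

lemma cheb_s_add: "cheb_s a (m + n) = cheb_s a m * cheb_t a n + cheb_t a m * cheb_s a n"
proof (rule chebyshev_recursion_unique[where x = a and n = m])
  fix m show "cheb_s a (m + 1 + n) = 2 * a * cheb_s a (m + n) - cheb_s a (m - 1 + n)"
    using cheb_s_rec[of a "m + n"] by (simp add: algebra_simps)
  show "cheb_s a (1 + n) = cheb_s a 1 * cheb_t a n + cheb_t a 1 * cheb_s a n"
    using cheb_s_Suc[of a n] by (simp add: add.commute)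
qed (simp_all add: cheb_t_rec cheb_s_rec algebra_simps)

text \<open>Parity in \<open>m\<close> cancels the terms containing \<open>cheb_s a m\<close>. What
  remains is the recursion along steps of length \<open>m\<close>, with multiplier
  \<open>2 * cheb_t a m\<close>.\<close>

lemma cheb_t_add_plus_diff: "cheb_t a (n + m) + cheb_t a (n - m) = 2 * cheb_t a m * cheb_t a n"
  using cheb_t_add[of a n m] cheb_t_add[of a n "- m"] by (simp add: algebra_simps)

lemma cheb_s_add_plus_diff: "cheb_s a (n + m) + cheb_s a (n - m) = 2 * cheb_t a m * cheb_s a n"
  using cheb_s_add[of a n m] cheb_s_add[of a n "- m"] by (simp add: algebra_simps)

section \<open>Binomial expansion of the powers\<close>

text \<open>
  The image of \<open>(a + X)\<^sup>n\<close> under the linear functional \<open>X\<^sup>k \<mapsto> f k\<close>.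
\<close>

definition binomial_functional :: "int \<Rightarrow> (nat \<Rightarrow> int) \<Rightarrow> nat \<Rightarrow> int" where
  "binomial_functional a f n = (\<Sum>k\<le>n. of_nat (n choose k) * a ^ (n - k) * f k)"

text \<open>One more factor \<open>a + X\<close>: multiplying by \<open>X\<close> shifts the
  argument of \<open>f\<close>, and Pascal's rule separates the two contributions.\<close>

lemma binomial_functional_Suc:
  "binomial_functional a f (Suc n) =
    a * binomial_functional a f n + binomial_functional a (\<lambda>k. f (Suc k)) n"
proof -
  have "binomial_functional a f (Suc n) =
      a ^ Suc n * f 0 + (\<Sum>k\<le>n. of_nat (Suc n choose Suc k) * a ^ (n - k) * f (Suc k))"
    unfolding binomial_functional_def by (subst sum.atMost_Suc_shift) simp
  also have "\<dots> = a ^ Suc n * f 0 + (\<Sum>k\<le>n. of_nat (n choose Suc k) * a ^ (n - k) * f (Suc k))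
      + binomial_functional a (\<lambda>k. f (Suc k)) n"
    by (simp add: binomial_functional_def sum.distrib[symmetric] algebra_simps)
  also have "a ^ Suc n * f 0 + (\<Sum>k\<le>n. of_nat (n choose Suc k) * a ^ (n - k) * f (Suc k))
      = (\<Sum>k\<le>Suc n. of_nat (n choose k) * a ^ (Suc n - k) * f k)"
    by (subst sum.atMost_Suc_shift) simp
  also have "\<dots> = a * binomial_functional a f n"
    by (simp add: binomial_functional_def sum_distrib_left Suc_diff_le mult_ac)
  finally show ?thesis .
qed

lemma binomial_functional_mult:
  "binomial_functional a (\<lambda>k. c * f k) n = c * binomial_functional a f n"
  by (simp add: binomial_functional_def sum_distrib_left mult_ac)

text \<open>\<open>p\<close> divides every inner binomial coefficient, so only the two end terms
  survive.\<close>

lemma binomial_functional_prime: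
  assumes "prime (p :: nat)"
  shows "[binomial_functional a f p = a ^ p * f 0 + f p] (mod int p)"
proof -
  have "{..p} = insert 0 (insert p {0<..<p})" "p > 0"
    using prime_gt_0_nat[OF assms] by auto
  then have "binomial_functional a f p - (a ^ p * f 0 + f p) =
      (\<Sum>k\<in>{0<..<p}. of_nat (p choose k) * a ^ (p - k) * f k)"
    by (simp add: binomial_functional_def)
  also have "int p dvd \<dots>"
    using assms by (intro dvd_sum dvd_mult2) (auto intro!: dvd_choose_prime)
  finally show ?thesis by (simp add: cong_iff_dvd_diff)
qed

text \<open>Take \<open>X = sqrt d\<close>: even powers are rational, and odd ones are
  \<open>d ^ (k div 2)\<close> times \<open>sqrt d\<close>. The two functionals read off these two
  components.\<close>

lemma cheb_binomial:
  fixes a :: int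
  defines "d \<equiv> a\<^sup>2 - 1"
  shows "cheb_t a (int n) = binomial_functional a (\<lambda>k. if even k then d ^ (k div 2) else 0) n \<and>
    cheb_s a (int n) = binomial_functional a (\<lambda>k. if odd k then d ^ (k div 2) else 0) n"
    (is "_ = binomial_functional a ?e n \<and> _ = binomial_functional a ?o n")
proof (induction n)
  case 0
  show ?case by (simp add: binomial_functional_def)
next
  case (Suc n)
  have "(\<lambda>k. ?e (Suc k)) = (\<lambda>k. d * ?o k)" "(\<lambda>k. ?o (Suc k)) = ?e"
    by (auto elim!: oddE)
  moreover have "cheb_t a (int (Suc n)) = a * cheb_t a (int n) + d * cheb_s a (int n)"
    "cheb_s a (int (Suc n)) = a * cheb_s a (int n) + cheb_t a (int n)"
    using cheb_t_Suc[of a "int n"] cheb_s_Suc[of a "int n"] by (simp_all add: d_def add.commute)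
  ultimately show ?case
    using Suc.IH by (simp only: binomial_functional_Suc binomial_functional_mult)
qed

section \<open>Prime indices and their multiples\<close>

lemma fermat_theorem_int:
  assumes "prime (p :: nat)"
  shows "[a ^ p = a] (mod int p)"
proof -
  define b where "b = nat (a mod int p)"
  have b: "[a = int b] (mod int p)"
    using prime_gt_0_nat[OF assms] by (simp add: b_def cong_def)
  \<comment> \<open>The extra factor \<open>b\<close> also covers the case where \<open>p\<close>
    divides \<open>b\<close>.\<close>
  have "[b ^ (p - 1) * b = b] (mod p)"
  proof (cases "p dvd b")
    case True
    then show ?thesis by (simp add: cong_def)
  next
    case False
    then show ?thesis
      using cong_scalar_right[OF fermat_theorem[OF assms], of b b] by simp
  qed
  then have "[b ^ p = b] (mod p)"
    using prime_gt_0_nat[OF assms] by (simp only: power_minus_mult)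
  then have "[int b ^ p = int b] (mod int p)"
    by (metis cong_int_iff of_nat_power)
  then show ?thesis
    using b by (meson cong_pow cong_sym cong_trans)
qed

text \<open>As \<open>p\<close> is odd, the surviving end terms are \<open>a ^ p\<close> for
  \<open>cheb_t\<close> and \<open>d ^ (p div 2)\<close> for \<open>cheb_s\<close>; Fermat's theorem
  and Euler's criterion evaluate them.\<close>

lemma cheb_prime:
  assumes "prime (p :: nat)" "odd p"
  shows cheb_t_prime: "[cheb_t a (int p) = a] (mod int p)"
    and cheb_s_prime: "[cheb_s a (int p) = Legendre (a\<^sup>2 - 1) (int p)] (mod int p)"
proof -
  show "[cheb_t a (int p) = a] (mod int p)"
    using binomial_functional_prime[OF assms(1), of a "\<lambda>k. if even k then (a\<^sup>2 - 1) ^ (k div 2) else 0"]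
      assms(2) cheb_binomial[of a p] fermat_theorem_int[OF assms(1), of a] by (auto intro: cong_trans)
  have "2 < p"
    using assms prime_ge_2_nat[of p] by (cases "p = 2") auto
  then have "[Legendre (a\<^sup>2 - 1) (int p) = (a\<^sup>2 - 1) ^ (p div 2)] (mod int p)"
    using euler_criterion[OF assms(1), of "a\<^sup>2 - 1"] assms(2) by (auto elim!: oddE)
  moreover have "[cheb_s a (int p) = (a\<^sup>2 - 1) ^ (p div 2)] (mod int p)"
    using binomial_functional_prime[OF assms(1), of a "\<lambda>k. if odd k then (a\<^sup>2 - 1) ^ (k div 2) else 0"]
      assms(2) cheb_binomial[of a p] by simp
  ultimately show "[cheb_s a (int p) = Legendre (a\<^sup>2 - 1) (int p)] (mod int p)"
    using cong_sym cong_trans by blast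
qed

lemma cheb_mult_prime:
  fixes P :: int
  assumes "prime P" "odd P"
  shows cheb_t_mult_prime: "[cheb_t a (n * P) = cheb_t a n] (mod P)"
    and cheb_s_mult_prime: "[cheb_s a (n * P) = Legendre (a\<^sup>2 - 1) P * cheb_s a n] (mod P)"
proof -
  obtain p :: nat where P: "P = int p"
    using prime_ge_0_int[OF assms(1)] nonneg_int_cases by blast
  then have p: "prime p" "odd p"
    using assms by (simp_all add: prime_nat_int_transfer)
  note tP = cheb_t_prime[OF p, of a, folded P] and sP = cheb_s_prime[OF p, of a, folded P]
  show "[cheb_t a (n * P) = cheb_t a n] (mod P)"
  proof (rule chebyshev_recursion_cong_unique[where x = a and n = n])
    fix n
    have "cheb_t a ((n + 1) * P) = 2 * cheb_t a P * cheb_t a (n * P) - cheb_t a ((n - 1) * P)"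
      using cheb_t_add_plus_diff[of a "n * P" P] by (simp add: algebra_simps)
    also have "[\<dots> = 2 * a * cheb_t a (n * P) - cheb_t a ((n - 1) * P)] (mod P)"
      by (intro cong_diff cong_mult tP cong_refl)
    finally show "[cheb_t a ((n + 1) * P) = 2 * a * cheb_t a (n * P) - cheb_t a ((n - 1) * P)] (mod P)" .
  qed (use tP in \<open>simp_all add: cheb_t_rec\<close>)
  show "[cheb_s a (n * P) = Legendre (a\<^sup>2 - 1) P * cheb_s a n] (mod P)"
  \<comment> \<open>The Legendre factor enters through the initial value at
    \<open>n = 1\<close>.\<close>
  proof (rule chebyshev_recursion_cong_unique[where x = a and n = n])
    fix n
    have "cheb_s a ((n + 1) * P) = 2 * cheb_t a P * cheb_s a (n * P) - cheb_s a ((n - 1) * P)"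
      using cheb_s_add_plus_diff[of a "n * P" P] by (simp add: algebra_simps)
    also have "[\<dots> = 2 * a * cheb_s a (n * P) - cheb_s a ((n - 1) * P)] (mod P)"
      by (intro cong_diff cong_mult tP cong_refl)
    finally show "[cheb_s a ((n + 1) * P) = 2 * a * cheb_s a (n * P) - cheb_s a ((n - 1) * P)] (mod P)" .
  qed (use sP in \<open>simp_all add: cheb_s_rec algebra_simps\<close>)
qed

lemma Legendre_cases: "Legendre a p \<in> {-1, 0, 1}"
  by (simp add: Legendre_def)

lemma cheb_s_mult_prime_diff:
  fixes P :: int
  assumes "prime P" "odd P"
  shows "[cheb_s a (n * P - Legendre (a\<^sup>2 - 1) P * n) = 0] (mod P)"
proof -
  define e where "e = Legendre (a\<^sup>2 - 1) P"
  have "cheb_s a (n * P - e * n) =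
      cheb_s a (n * P) * cheb_t a (e * n) - cheb_t a (n * P) * cheb_s a (e * n)"
    using cheb_s_add[of a "n * P" "- (e * n)"] by simp
  also have "[\<dots> = e * cheb_s a n * cheb_t a (e * n) - cheb_t a n * cheb_s a (e * n)] (mod P)"
    unfolding e_def
    by (intro cong_diff cong_mult cong_refl cheb_t_mult_prime cheb_s_mult_prime assms)
  \<comment> \<open>For \<open>e = 0\<close> both terms vanish since \<open>cheb_s a 0 = 0\<close>;
    for \<open>e = 1\<close> and, by parity, for \<open>e = -1\<close> they cancel.\<close>
  also have "e * cheb_s a n * cheb_t a (e * n) - cheb_t a n * cheb_s a (e * n) = 0"
    using Legendre_cases[of "a\<^sup>2 - 1" P] by (auto simp: e_def[symmetric])
  finally show ?thesis by (simp add: e_def)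
qed

lemma cheb_t_mult_prime_Suc:
  fixes P :: int
  assumes "prime P" "odd P" "\<not> P dvd a\<^sup>2 - 1"
  shows "[cheb_t a (n * P + 1) = cheb_t a (Legendre (a\<^sup>2 - 1) P * n + 1)] (mod P)"
proof -
  define e where "e = Legendre (a\<^sup>2 - 1) P"
  have "e \<in> {-1, 1}"
    using assms(3) by (simp add: e_def Legendre_def cong_0_iff)
  have "[cheb_t a (n * P + 1) = a * cheb_t a n + (a\<^sup>2 - 1) * (e * cheb_s a n)] (mod P)"
    unfolding cheb_t_Suc e_def
    by (intro cong_add cong_mult cong_refl cheb_t_mult_prime cheb_s_mult_prime assms)
  \<comment> \<open>For \<open>e = 1\<close> or \<open>e = -1\<close>, parity gives
    \<open>e * cheb_s a n = cheb_s a (e * n)\<close> and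
    \<open>cheb_t a n = cheb_t a (e * n)\<close>.\<close>
  also have "a * cheb_t a n + (a\<^sup>2 - 1) * (e * cheb_s a n) = cheb_t a (e * n + 1)"
    unfolding cheb_t_Suc using \<open>e \<in> {-1, 1}\<close> by auto
  finally show ?thesis by (simp add: e_def)
qed

section \<open>Oddness of the modulus and the final congruences\<close>

text \<open>This rules out the prime 2. If \<open>q - r\<close> is odd, so is
  \<open>q ^ p - r ^ p\<close> and each of its divisors; otherwise \<open>q\<close> and
  \<open>r\<close> are odd and the quotient is a sum of \<open>p\<close> odd terms.\<close>

lemma odd_Phi2:
  assumes "coprime q r" "q \<noteq> r" "odd p"
  shows "odd (Phi2 p q r)"
proof (cases "even (q - r)")
  case False
  then have "odd (q ^ p - r ^ p)"
    using assms(3) by (auto simp: odd_pos)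
  then show ?thesis
    by (metis Phi2_mult dvd_mult)
next
  case True
  moreover have "\<not> (even q \<and> even r)"
    using assms(1) by (meson coprime_common_divisor odd_one)
  ultimately have "odd q" "odd r" by auto
  have "(q - r) * Phi2 p q r = (q - r) * (\<Sum>i<p. r ^ (p - Suc i) * q ^ i)"
    using Phi2_mult[of q r p] power_diff_sumr2[of q p r] by simp
  then have "Phi2 p q r = (\<Sum>i<p. r ^ (p - Suc i) * q ^ i)"
    using assms(2) by simp
  then show ?thesis
    using \<open>odd q\<close> \<open>odd r\<close> \<open>odd p\<close> by (simp add: even_sum_iff)
qed

theorem theorem1p1:
  fixes q a :: int and p :: nat
  assumes "q \<noteq> 0" "q \<noteq> 1" "q \<noteq> -1"
    and "a \<noteq> 0" "a \<noteq> 1" "a \<noteq> -1"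
    and "prime p" "odd p"
  shows
    "(\<forall>\<epsilon>. prime (Phi1 p q) \<and> \<not> Phi1 p q dvd a^2 - 1 \<and> \<epsilon> = Legendre (a^2 - 1) (Phi1 p q) \<longrightarrow>
        [poly (chebyshev_T (q^p)) a = poly (chebyshev_T (q + \<epsilon> - 1)) a] (mod Phi1 p q) \<and>
        [poly (chebyshev_U (q^p - \<epsilon> * (q - 1) - 2)) a = 0] (mod Phi1 p q)) \<and>
     (\<forall>r \<epsilon>. gcd q r = 1 \<and> prime (Phi2 p q r) \<and> \<epsilon> = Legendre (a^2 - 1) (Phi2 p q r) \<longrightarrow>
        [poly (chebyshev_T (q^p - r^p)) a = poly (chebyshev_T (q - r)) a] (mod Phi2 p q r) \<and>
        [poly (chebyshev_U (q^p - r^p - \<epsilon> * (q - r) - 1)) a = 0] (mod Phi2 p q r))"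
proof (intro conjI allI impI; elim conjE)
  fix r \<epsilon>
  assume "gcd q r = 1" and P: "prime (Phi2 p q r)" and \<epsilon>: "\<epsilon> = Legendre (a^2 - 1) (Phi2 p q r)"
  \<comment> \<open>If \<open>q = r\<close>, the gcd would be the absolute value of
    \<open>q\<close>, which is not 1.\<close>
  then have "q \<noteq> r"
    using assms(2,3) by auto
  then have odd: "odd (Phi2 p q r)"
    using odd_Phi2 \<open>gcd q r = 1\<close> \<open>odd p\<close> by (simp add: coprime_iff_gcd_eq_1)
  show "[poly (chebyshev_T (q^p - r^p)) a = poly (chebyshev_T (q - r)) a] (mod Phi2 p q r)"
    using cheb_t_mult_prime[OF P odd, of a "q - r"] by (simp add: cheb_t_def Phi2_mult)
  show "[poly (chebyshev_U (q^p - r^p - \<epsilon> * (q - r) - 1)) a = 0] (mod Phi2 p q r)"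
    using cheb_s_mult_prime_diff[OF P odd, of a "q - r"]
    by (simp add: cheb_s_def Phi2_mult \<epsilon>)
next
  fix \<epsilon>
  assume P: "prime (Phi1 p q)" and ndvd: "\<not> Phi1 p q dvd a^2 - 1"
    and \<epsilon>: "\<epsilon> = Legendre (a^2 - 1) (Phi1 p q)"
  have "Phi1 p q = Phi2 p q 1"
    by (simp add: Phi1_def Phi2_def)
  then have odd: "odd (Phi1 p q)"
    using odd_Phi2[of q 1 p] assms(2) \<open>odd p\<close> by simp
  have "poly (chebyshev_T (q^p)) a = cheb_t a ((q - 1) * Phi1 p q + 1)"
    by (simp add: cheb_t_def Phi1_mult)
  also have "[\<dots> = cheb_t a (\<epsilon> * (q - 1) + 1)] (mod Phi1 p q)"
    unfolding \<epsilon> by (rule cheb_t_mult_prime_Suc[OF P odd ndvd])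
  \<comment> \<open>For \<open>\<epsilon> = -1\<close> the left index is \<open>2 - q\<close>, the
    reflection of \<open>q - 2\<close>.\<close>
  also have "cheb_t a (\<epsilon> * (q - 1) + 1) = cheb_t a (q + \<epsilon> - 1)"
  proof -
    have "\<epsilon> \<in> {-1, 1}"
      using ndvd by (simp add: \<epsilon> Legendre_def cong_0_iff)
    then show ?thesis
      using cheb_t_minus[of a "q - 2"] by auto
  qed
  finally show "[poly (chebyshev_T (q^p)) a = poly (chebyshev_T (q + \<epsilon> - 1)) a] (mod Phi1 p q)"
    by (simp add: cheb_t_def)
  \<comment> \<open>In the offset -2, one unit comes from \<open>q ^ p - 1\<close> and one from the
    index shift in \<open>cheb_s\<close>.\<close>
  show "[poly (chebyshev_U (q^p - \<epsilon> * (q - 1) - 2)) a = 0] (mod Phi1 p q)"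
    using cheb_s_mult_prime_diff[OF P odd, of a "q - 1"]
    by (simp add: cheb_s_def Phi1_mult \<epsilon> diff_diff_eq add.commute)
qed

end
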